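(* Let $N\ge 1$ be an integer, $A=(A_{ij})\in\mathbb{R}^{3N\times 3N}$ and $b\in\mathbb{R}^{3N}$. Assume that $A_{ii}>0$ for all $1\le i\le 3N$. Starting from an initial guess $u^{(0)}\in\mathbb{R}^{3N}$, consider the iteration defined for $k\ge 0$ and $1\le I\le N$ by $$A_{3I-2,3I-2}\,u^{(k+1)}_{3I-2}=b_{3I-2}-\sum_{\substack{1\le j\le 3N\\ j\ne 3I-2}}A_{3I-2,j}\,u^{(k)}_j,$$ $$A_{3I-1,3I-1}\,u^{(k+1)}_{3I-1}=b_{3I-1}-\sum_{\substack{1\le j\le 3N\\ j\ne 3I-1}}A_{3I-1,j}\,u^{(k)}_j,$$ $$A_{3I,3I}\,u^{(k+1)}_{3I}=\Big(b_{3I}-\sum_{\substack{1\le j\le 3N\\ j\ne 3I}}A_{3I,j}\,u^{(k)}_j\Big)^+ .$$ Then the iterations are well defined. Moreover, if the iterates $u^{(k)}$ converge to a limit $u\in\mathbb{R}^{3N}$, then $u$ is a solution of the system $$(Au-b)_{3I-2}=0,\qquad (Au-b)_{3I-1}=0,\qquad \min\{u_{3I},\,(Au-b)_{3I}\}=0\qquad\text{for all }1\le I\le N.$$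
   Context: For a real number $a$, $a^+=\max\{a,0\}$ denotes its positive part. For $u\in\mathbb{R}^{3N}$, $(Au-b)_i=\sum_{j=1}^{3N}A_{ij}u_j-b_i$ denotes the $i$-th component of $Au-b$. The iterations are "well defined" in the sense that each equation uniquely determines the corresponding component of $u^{(k+1)}$ from $u^{(k)}$. *)

theory Defs
  imports "HOL-Analysis.Analysis"
begin

text \<open>Vectors of dimension \<open>3 * N\<close> have type \<^typ>\<open>real ^ 'm\<close>, together with an enumeration
  \<open>e\<close> of the index type \<open>'m\<close> by \<open>{1..3 * N}\<close>: the component \<open>u\<^sub>i\<close> is \<open>u $ e i\<close> and the entry
  \<open>A\<^sub>i\<^sub>j\<close> is \<open>A $ e i $ e j\<close>, with \<open>i\<close> and \<open>j\<close> in \<open>{1..3 * N}\<close>.\<close>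

definition pos_part :: "real \<Rightarrow> real" where
  "pos_part a = max a 0"

definition jacobi_rhs ::
  "nat \<Rightarrow> (nat \<Rightarrow> 'm::finite) \<Rightarrow> real ^ 'm ^ 'm \<Rightarrow> real ^ 'm \<Rightarrow> real ^ 'm \<Rightarrow> nat \<Rightarrow> real" where
  "jacobi_rhs N e A b v i = b $ e i - (\<Sum>j\<in>{1..3 * N} - {i}. A $ e i $ e j * v $ e j)"

definition is_iteration ::
  "nat \<Rightarrow> (nat \<Rightarrow> 'm::finite) \<Rightarrow> real ^ 'm ^ 'm \<Rightarrow> real ^ 'm \<Rightarrow> real ^ 'm \<Rightarrow> (nat \<Rightarrow> real ^ 'm) \<Rightarrow> bool"
  where
  "is_iteration N e A b u0 u \<longleftrightarrow>
     u 0 = u0 \<and>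
     (\<forall>k. \<forall>I\<in>{1..N}.
        A $ e (3*I - 2) $ e (3*I - 2) * u (Suc k) $ e (3*I - 2) = jacobi_rhs N e A b (u k) (3*I - 2) \<and>
        A $ e (3*I - 1) $ e (3*I - 1) * u (Suc k) $ e (3*I - 1) = jacobi_rhs N e A b (u k) (3*I - 1) \<and>
        A $ e (3*I) $ e (3*I) * u (Suc k) $ e (3*I) = pos_part (jacobi_rhs N e A b (u k) (3*I)))"

definition is_solution ::
  "nat \<Rightarrow> (nat \<Rightarrow> 'm::finite) \<Rightarrow> real ^ 'm ^ 'm \<Rightarrow> real ^ 'm \<Rightarrow> real ^ 'm \<Rightarrow> bool" where
  "is_solution N e A b u \<longleftrightarrow>
     (\<forall>I\<in>{1..N}.
        (A *v u - b) $ e (3*I - 2) = 0 \<and>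
        (A *v u - b) $ e (3*I - 1) = 0 \<and>
        min (u $ e (3*I)) ((A *v u - b) $ e (3*I)) = 0)"

end

theory Submission
  imports Defs
begin

text \<open>The iteration is \<open>u\<^sup>k\<^sup>+\<^sup>1 = F u\<^sup>k\<close> for a continuous map \<open>F\<close>, so a limit \<open>l\<close> is a fixed point:
  \<open>A\<^sub>i\<^sub>i l\<^sub>i\<close> equals the \<open>i\<close>-th Jacobi right-hand side \<open>r\<^sub>i\<close>, or its positive part if \<open>3\<close> divides \<open>i\<close>.
  Since \<open>(A l - b)\<^sub>i = A\<^sub>i\<^sub>i l\<^sub>i - r\<^sub>i\<close>, the latter case is complementarity, because \<open>a x = r\<^sup>+\<close> with \<open>a > 0\<close>
  means \<open>min x (a x - r) = 0\<close>.\<close>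

text \<open>One formula for all rows: the test \<open>3 dvd i\<close> selects the rows with the
  positive part, so the three equations of a block need not be treated separately.\<close>

definition projected_rhs ::
  "nat \<Rightarrow> (nat \<Rightarrow> 'm::finite) \<Rightarrow> real ^ 'm ^ 'm \<Rightarrow> real ^ 'm \<Rightarrow> real ^ 'm \<Rightarrow> nat \<Rightarrow> real" where
  "projected_rhs N e A b v i =
     (if 3 dvd i then pos_part (jacobi_rhs N e A b v i) else jacobi_rhs N e A b v i)"

text \<open>The map \<open>F\<close> itself. Vectors are indexed by \<open>'m\<close> but right-hand
  sides by numbers, so \<open>inv_into\<close> recovers the number of the component
  \<open>m\<close>.\<close>

definition jacobi_step ::
  "nat \<Rightarrow> (nat \<Rightarrow> 'm::finite) \<Rightarrow> real ^ 'm ^ 'm \<Rightarrow> real ^ 'm \<Rightarrow> real ^ 'm \<Rightarrow> real ^ 'm" where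
  "jacobi_step N e A b v =
     (\<chi> m. projected_rhs N e A b v (inv_into {1..3 * N} e m) / A $ m $ m)"

lemma triple_mem:
  fixes N :: nat
  assumes "I \<in> {1..N}"
  shows "3*I - 2 \<in> {1..3 * N}" and "3*I - 1 \<in> {1..3 * N}" and "3*I \<in> {1..3 * N}"
  using assms by auto

text \<open>Turns statements in blocks of three into statements about single rows.\<close>

lemma ball_triples:
  fixes N :: nat
  shows "(\<forall>I\<in>{1..N}. P (3*I - 2) \<and> P (3*I - 1) \<and> P (3*I)) \<longleftrightarrow> (\<forall>i\<in>{1..3 * N}. P i)"
proof (intro iffI ballI)
  fix i assume P: "\<forall>I\<in>{1..N}. P (3*I - 2) \<and> P (3*I - 1) \<and> P (3*I)" and i: "i \<in> {1..3 * N}"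
  \<comment> \<open>This is \<open>i / 3\<close> rounded up, the number of the block that contains
    row \<open>i\<close>.\<close>
  define I where "I = (i + 2) div 3"
  have "I \<in> {1..N}" and "i = 3*I - 2 \<or> i = 3*I - 1 \<or> i = 3*I"
    using i unfolding I_def by auto
  with P show "P i" by metis
qed (blast intro: triple_mem)

lemma projected_rhs_simps:
  assumes "I \<ge> 1"
  shows "projected_rhs N e A b v (3*I - 2) = jacobi_rhs N e A b v (3*I - 2)"
    and "projected_rhs N e A b v (3*I - 1) = jacobi_rhs N e A b v (3*I - 1)"
    and "projected_rhs N e A b v (3*I) = pos_part (jacobi_rhs N e A b v (3*I))"
proof -
  \<comment> \<open>Subtraction on \<open>nat\<close> is truncated: for \<open>I = 0\<close> both
    differences would be 0, which 3 divides.\<close>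
  have "\<not> 3 dvd 3*I - 2" and "\<not> 3 dvd 3*I - 1"
    using assms by presburger+
  then show "projected_rhs N e A b v (3*I - 2) = jacobi_rhs N e A b v (3*I - 2)"
    and "projected_rhs N e A b v (3*I - 1) = jacobi_rhs N e A b v (3*I - 1)"
    and "projected_rhs N e A b v (3*I) = pos_part (jacobi_rhs N e A b v (3*I))"
    by (simp_all add: projected_rhs_def)
qed

lemma is_iteration_iff_projected_rhs:
  "is_iteration N e A b u0 u \<longleftrightarrow>
     u 0 = u0 \<and>
     (\<forall>k. \<forall>i\<in>{1..3 * N}. A $ e i $ e i * u (Suc k) $ e i = projected_rhs N e A b (u k) i)"
  unfolding is_iteration_def ball_triples[symmetric]
  \<comment> \<open>Keeping \<open>1\<close> from becoming \<open>Suc 0\<close> lets the rule for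
    \<open>3*I - 1\<close> match.\<close>
  by (simp add: projected_rhs_simps del: One_nat_def)

text \<open>Surjectivity of \<open>e\<close> reduces equality of vectors to the numbered components,
  injectivity cancels \<open>inv_into\<close>, and the positive diagonal permits the
  division.\<close>

lemma eq_jacobi_step_iff:
  fixes e :: "nat \<Rightarrow> 'm::finite"
  assumes e: "bij_betw e {1..3 * N} (UNIV :: 'm set)"
    and pos: "\<forall>i\<in>{1..3 * N}. A $ e i $ e i > 0"
  shows "w = jacobi_step N e A b v \<longleftrightarrow>
    (\<forall>i\<in>{1..3 * N}. A $ e i $ e i * w $ e i = projected_rhs N e A b v i)"
proof -
  have "(\<forall>m. P m) \<longleftrightarrow> (\<forall>i\<in>{1..3 * N}. P (e i))" for P
    using bij_betw_imp_surj_on[OF e] by (metis UNIV_I imageE)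
  then have "w = jacobi_step N e A b v \<longleftrightarrow>
    (\<forall>i\<in>{1..3 * N}. w $ e i = jacobi_step N e A b v $ e i)"
    unfolding vec_eq_iff by this
  also have "\<dots> \<longleftrightarrow>
    (\<forall>i\<in>{1..3 * N}. A $ e i $ e i * w $ e i = projected_rhs N e A b v i)"
  proof (rule ball_cong[OF refl])
    fix i assume i: "i \<in> {1..3 * N}"
    then have "inv_into {1..3 * N} e (e i) = i"
      using bij_betw_imp_inj_on[OF e] by (simp only: inv_into_f_f)
    moreover have "A $ e i $ e i > 0" using pos i by blast
    ultimately show "w $ e i = jacobi_step N e A b v $ e i \<longleftrightarrow>
        A $ e i $ e i * w $ e i = projected_rhs N e A b v i"
      unfolding jacobi_step_def by (auto simp: field_simps)
  qed
  finally show ?thesis .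
qed

text \<open>An explicit formula for the sequence yields its existence and its uniqueness at
  once.\<close>

lemma is_iteration_iff_funpow:
  fixes e :: "nat \<Rightarrow> 'm::finite"
  assumes "bij_betw e {1..3 * N} (UNIV :: 'm set)"
    and "\<forall>i\<in>{1..3 * N}. A $ e i $ e i > 0"
  shows "is_iteration N e A b u0 u \<longleftrightarrow> u = (\<lambda>k. (jacobi_step N e A b ^^ k) u0)"
proof -
  have "is_iteration N e A b u0 u \<longleftrightarrow> u 0 = u0 \<and> (\<forall>k. u (Suc k) = jacobi_step N e A b (u k))"
    unfolding is_iteration_iff_projected_rhs eq_jacobi_step_iff[OF assms] ..
  also have "\<dots> \<longleftrightarrow> u = (\<lambda>k. (jacobi_step N e A b ^^ k) u0)"
  proof
    assume u: "u 0 = u0 \<and> (\<forall>k. u (Suc k) = jacobi_step N e A b (u k))"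
    have "u k = (jacobi_step N e A b ^^ k) u0" for k
      using u by (induction k) auto
    then show "u = (\<lambda>k. (jacobi_step N e A b ^^ k) u0)" ..
  qed simp
  finally show ?thesis .
qed

text \<open>The Jacobi right-hand side is affine in the iterate, and the maximum with 0 is
  continuous.\<close>

lemma tendsto_projected_rhs:
  assumes "(u \<longlongrightarrow> l) F"
  shows "((\<lambda>k. projected_rhs N e A b (u k) i) \<longlongrightarrow> projected_rhs N e A b l i) F"
proof -
  have "((\<lambda>k. jacobi_rhs N e A b (u k) i) \<longlongrightarrow> jacobi_rhs N e A b l i) F"
    unfolding jacobi_rhs_def by (intro tendsto_intros assms)
  then show ?thesis
    unfolding projected_rhs_def pos_part_def by (auto intro: tendsto_max)
qed

lemma residual_eq_jacobi_rhs:
  fixes e :: "nat \<Rightarrow> 'm::finite"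
  assumes e: "bij_betw e {1..3 * N} (UNIV :: 'm set)" and i: "i \<in> {1..3 * N}"
  shows "(A *v v - b) $ e i = A $ e i $ e i * v $ e i - jacobi_rhs N e A b v i"
proof -
  have "(A *v v) $ e i = (\<Sum>j\<in>{1..3 * N}. A $ e i $ e j * v $ e j)"
    unfolding matrix_vector_mult_def by (simp add: sum.reindex_bij_betw[OF e, symmetric])
  also have "\<dots> = A $ e i $ e i * v $ e i + (\<Sum>j\<in>{1..3 * N} - {i}. A $ e i $ e j * v $ e j)"
    using i by (intro sum.remove) auto
  finally show ?thesis by (simp add: jacobi_rhs_def)
qed

text \<open>If \<open>r \<ge> 0\<close>, the residual vanishes and \<open>x = r / a\<close> is
  nonnegative; if \<open>r < 0\<close>, then \<open>x = 0\<close> and the residual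
  \<open>- r\<close> is positive.\<close>

lemma min_residual_eq_0:
  fixes a x r :: real
  assumes "a > 0" and "a * x = pos_part r"
  shows "min x (a * x - r) = 0"
proof (cases "r \<ge> 0")
  case True
  with assms have "a * x = r" by (simp add: pos_part_def)
  then have "x = r / a" using \<open>a > 0\<close> by (simp add: field_simps)
  with True \<open>a > 0\<close> \<open>a * x = r\<close> show ?thesis by simp
next
  case False
  with assms show ?thesis by (simp add: pos_part_def max_def)
qed

lemma is_solution_if_fixed_point:
  fixes e :: "nat \<Rightarrow> 'm::finite"
  assumes e: "bij_betw e {1..3 * N} (UNIV :: 'm set)"
    and pos: "\<forall>i\<in>{1..3 * N}. A $ e i $ e i > 0"
    and fixed: "\<forall>i\<in>{1..3 * N}. A $ e i $ e i * l $ e i = projected_rhs N e A b l i"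
  shows "is_solution N e A b l"
  unfolding is_solution_def
proof
  fix I assume I: "I \<in> {1..N}"
  note mem = triple_mem[OF I]
  have "I \<ge> 1" using I by simp
  note rhs = projected_rhs_simps[OF this]
  show "(A *v l - b) $ e (3*I - 2) = 0 \<and> (A *v l - b) $ e (3*I - 1) = 0 \<and>
      min (l $ e (3*I)) ((A *v l - b) $ e (3*I)) = 0"
    unfolding mem[THEN residual_eq_jacobi_rhs[OF e]]
    using mem[THEN bspec[OF fixed]] mem(3)[THEN bspec[OF pos]]
    unfolding rhs by (intro conjI min_residual_eq_0) simp_all
qed

lemma limit_is_solution:
  fixes e :: "nat \<Rightarrow> 'm::finite"
  assumes e: "bij_betw e {1..3 * N} (UNIV :: 'm set)"
    and pos: "\<forall>i\<in>{1..3 * N}. A $ e i $ e i > 0"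
    and iter: "is_iteration N e A b u0 u" and lim: "u \<longlonglongrightarrow> l"
  shows "is_solution N e A b l"
proof (rule is_solution_if_fixed_point[OF e pos], rule ballI)
  fix i assume i: "i \<in> {1..3 * N}"
  \<comment> \<open>The shifted sequence has the same limit \<open>l\<close>; passing to the limit
    on both sides of the iteration gives the fixed-point equation.\<close>
  have "(\<lambda>k. A $ e i $ e i * u (Suc k) $ e i) \<longlonglongrightarrow> A $ e i $ e i * l $ e i"
    by (intro tendsto_intros LIMSEQ_Suc lim)
  moreover have "(\<lambda>k. A $ e i $ e i * u (Suc k) $ e i) = (\<lambda>k. projected_rhs N e A b (u k) i)"
    using iter i by (simp only: is_iteration_iff_projected_rhs)
  ultimately show "A $ e i $ e i * l $ e i = projected_rhs N e A b l i"
    using LIMSEQ_unique tendsto_projected_rhs[OF lim] by metis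
qed

theorem theorem1p1:
  fixes N :: nat
    and e :: "nat \<Rightarrow> 'm::finite"
    and A :: "real ^ 'm ^ 'm"
    and b :: "real ^ 'm"
    and u0 :: "real ^ 'm"
  assumes "N \<ge> 1"
    and "bij_betw e {1..3 * N} (UNIV :: 'm set)"
    and "\<forall>i\<in>{1..3 * N}. A $ e i $ e i > 0"
  shows "(\<forall>v. \<forall>I\<in>{1..N}.
            (\<exists>!x. A $ e (3*I - 2) $ e (3*I - 2) * x = jacobi_rhs N e A b v (3*I - 2)) \<and>
            (\<exists>!x. A $ e (3*I - 1) $ e (3*I - 1) * x = jacobi_rhs N e A b v (3*I - 1)) \<and>
            (\<exists>!x. A $ e (3*I) $ e (3*I) * x = pos_part (jacobi_rhs N e A b v (3*I)))) \<and>
         (\<exists>!u. is_iteration N e A b u0 u) \<and>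
         (\<forall>u l. is_iteration N e A b u0 u \<and> u \<longlonglongrightarrow> l \<longrightarrow> is_solution N e A b l)"
proof (intro conjI allI ballI)
  have unique: "\<exists>!x. A $ e i $ e i * x = r" if "i \<in> {1..3 * N}" for i r
  proof -
    have "A $ e i $ e i \<noteq> 0" using assms(3) that by fastforce
    then show ?thesis by (intro ex1I[of _ "r / A $ e i $ e i"]) (auto simp: field_simps)
  qed
  fix v I assume "I \<in> {1..N}"
  note triple_mem[OF this]
  then show "\<exists>!x. A $ e (3*I - 2) $ e (3*I - 2) * x = jacobi_rhs N e A b v (3*I - 2)"
    and "\<exists>!x. A $ e (3*I - 1) $ e (3*I - 1) * x = jacobi_rhs N e A b v (3*I - 1)"
    and "\<exists>!x. A $ e (3*I) $ e (3*I) * x = pos_part (jacobi_rhs N e A b v (3*I))"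
    by (simp_all only: unique)
next
  show "\<exists>!u. is_iteration N e A b u0 u"
    \<comment> \<open>The claim becomes unique existence of a \<open>u\<close> equal to a given
      sequence.\<close>
    unfolding is_iteration_iff_funpow[OF assms(2,3)] by blast
next
  fix u l
  show "is_iteration N e A b u0 u \<and> u \<longlonglongrightarrow> l \<longrightarrow> is_solution N e A b l"
    using limit_is_solution[OF assms(2,3)] by blast
qed

end
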